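(* Let $d\geqslant 1$ and $i$ be integers with $0\leqslant i\leqslant d$. Then \[D_{d,i}=2^{\frac{d(d-1)}{2}-i}\binom{d}{i}\frac{d+i}{d}.\]
   Context: For natural integers $a_1,\dots,a_d$ and $b_1,\dots,b_d$, the binomial determinant $\binom{a_1,\dots,a_d}{b_1,\dots,b_d}$ is the $d\times d$ determinant $\det\left(\binom{a_r}{b_s}\right)_{1\leqslant r,s\leqslant d}$ (with $\binom{a}{b}=0$ if $b>a$). For $0\leqslant i\leqslant d$, $D_{d,i}$ is the binomial determinant with top row $(d-1,d,\dots,d-2+i,d+i,\dots,2d-1)$ — i.e. the integers from $d-1$ to $2d-1$ in increasing order with $d-1+i$ omitted — and bottom row $(0,2,4,\dots,2(d-1))$. *)

theory Defs
  imports "Jordan_Normal_Form.Determinant"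
begin

text \<open>Rows are indexed by \<open>as\<close> and columns by \<open>bs\<close>. The lists are meant to have equal length;
  otherwise the matrix is not square and \<open>det\<close> returns 0.\<close>

definition binomial_det :: "nat list \<Rightarrow> nat list \<Rightarrow> int" where
  "binomial_det as bs =
     det (mat (length as) (length bs) (\<lambda>(r, s). int ((as ! r) choose (bs ! s))))"

text \<open>For \<open>d \<ge> 1\<close> and \<open>i \<le> d\<close> the top row has exactly \<open>d\<close> entries: \<open>[d - 1..<2 * d]\<close> lists the
  \<open>d + 1\<close> integers from \<open>d - 1\<close> to \<open>2 d - 1\<close>, of which \<open>d - 1 + i\<close> is dropped.\<close>

definition D :: "nat \<Rightarrow> nat \<Rightarrow> int" where
  "D d i = binomial_det
     (filter (\<lambda>k. k \<noteq> d - 1 + i) [d - 1..<2 * d])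
     (map (\<lambda>s. 2 * s) [0..<d])"

end

theory Submission
  imports Defs
begin

text \<open>Up to sign, the numbers \<open>D d i\<close> for \<open>0 \<le> i \<le> d\<close> are the maximal minors of the
  \<open>(d + 1) \<times> d\<close> matrix with entries \<open>(d - 1 + r) choose 2s\<close>, hence they are proportional to any
  vector in its left kernel. The expansion
  \<open>\<Sum>i. (-1)^i 2^(d - i) (d choose i) (1 + x)^(d + i) = (1 + x)^d (2 - (1 + x))^d = (1 - x\<^sup>2)^d\<close>
  has no odd coefficients, so the entries \<open>(-1)^i 2^(d - i) (d choose i) (d + i)\<close> (obtained by
  differentiating) give such a vector. The normalisation comes from \<open>D (d + 1) (d + 1) = D d 0\<close>,
  which follows from Vandermonde's convolution and one Laplace expansion.\<close>

section \<open>Maximal minors and left kernel vectors\<close>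

definition maximal_minor :: "(nat \<Rightarrow> nat \<Rightarrow> 'a::comm_ring_1) \<Rightarrow> nat \<Rightarrow> nat \<Rightarrow> 'a" where
  "maximal_minor f n k = det (mat n n (\<lambda>(r, s). f (if r < k then r else Suc r) s))"

text \<open>Only one term of the Laplace expansion along column \<open>n\<close> survives, and its
  cofactor involves only the first \<open>n\<close> columns.\<close>

lemma det_last_column_unit:
  fixes f :: "nat \<Rightarrow> nat \<Rightarrow> 'a::comm_ring_1"
  assumes "k \<le> n" and "\<And>r. r \<le> n \<Longrightarrow> f r n = (if r = k then c else 0)"
  shows "det (mat (Suc n) (Suc n) (\<lambda>(r, s). f r s)) = (-1) ^ (k + n) * c * maximal_minor f n k"
proof -
  let ?A = "mat (Suc n) (Suc n) (\<lambda>(r, s). f r s)"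
  have "det ?A = (\<Sum>r<Suc n. ?A $$ (r, n) * cofactor ?A r n)"
    by (rule laplace_expansion_column) auto
  also have "\<dots> = (\<Sum>r<Suc n. if r = k then c * cofactor ?A r n else 0)"
    using assms(2) by (intro sum.cong) auto
  also have "\<dots> = c * cofactor ?A k n"
    using assms(1) by simp
  also have "mat_delete ?A k n = mat n n (\<lambda>(r, s). f (if r < k then r else Suc r) s)"
    using assms(1) by (intro eq_matI) (auto simp: mat_delete_def)
  then have "cofactor ?A k n = (-1) ^ (k + n) * maximal_minor f n k"
    by (simp add: cofactor_def maximal_minor_def)
  finally show ?thesis
    by (simp add: algebra_simps)
qed

text \<open>Bordering \<open>f\<close> by the \<open>i\<close>-th unit column gives a square matrix
  whose determinant is, up to sign, the minor at \<open>i\<close>. Replacing its last row by the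
  combination of rows with coefficients \<open>(-1) ^ k * w k\<close> multiplies the determinant by
  \<open>(-1) ^ n * w n\<close> and clears that row except in the corner. The comparison of
  determinants divides by nothing, so it holds over any commutative ring.\<close>

lemma maximal_minors_proportional_to_left_kernel:
  fixes f :: "nat \<Rightarrow> nat \<Rightarrow> 'a::comm_ring_1"
  assumes ker: "\<And>s. s < n \<Longrightarrow> (\<Sum>k\<le>n. (-1) ^ k * w k * f k s) = 0" and "i \<le> n"
  shows "w n * maximal_minor f n i = w i * maximal_minor f n n"
proof -
  \<comment> \<open>\<open>g\<close> is the bordered matrix, \<open>t\<close> the row operation and
    \<open>h\<close> the product of \<open>t\<close> and \<open>g\<close>.\<close>
  define g where "g r s = (if s = n then if r = i then 1 else 0 else f r s)" for r s
  define h where "h r s = (if r = n then if s = n then (-1) ^ i * w i else 0 else g r s)" for r s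
  define t where "t r s = (if r = n then (-1) ^ s * w s else if r = s then 1 else 0)" for r s
  let ?M = "\<lambda>f :: nat \<Rightarrow> nat \<Rightarrow> 'a. mat (Suc n) (Suc n) (\<lambda>(r, s). f r s)"
  have minor_g: "maximal_minor g n i = maximal_minor f n i"
    unfolding maximal_minor_def g_def by (intro arg_cong[where f = det] eq_matI) auto
  have "det (?M g) = (-1) ^ (i + n) * 1 * maximal_minor g n i"
    by (rule det_last_column_unit) (use assms in \<open>auto simp: g_def\<close>)
  then have det_g: "det (?M g) = (-1) ^ (i + n) * maximal_minor f n i"
    by (simp add: minor_g)
  have det_t: "det (?M t) = (-1) ^ n * w n"
  proof -
    have "det (?M t) = (-1) ^ (n + n) * ((-1) ^ n * w n) * maximal_minor t n n"
      by (rule det_last_column_unit) (auto simp: t_def)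
    moreover have "maximal_minor t n n = det (1\<^sub>m n)"
      unfolding maximal_minor_def t_def by (intro arg_cong[where f = det] eq_matI) auto
    ultimately show ?thesis
      by (simp flip: mult_2)
  qed
  have det_h: "det (?M h) = (-1) ^ i * w i * maximal_minor f n n"
  proof -
    \<comment> \<open>Transposing turns the last row of \<open>h\<close>, zero outside the corner,
      into a last column that can be expanded.\<close>
    have "det (?M h) = det (transpose_mat (?M h))"
      by (rule det_transpose[symmetric, where n = "Suc n"]) auto
    also have "transpose_mat (?M h) = ?M (\<lambda>r s. h s r)"
      by (intro eq_matI) auto
    also have "det \<dots> = (-1) ^ (n + n) * ((-1) ^ i * w i) * maximal_minor (\<lambda>r s. h s r) n n"
      by (rule det_last_column_unit) (auto simp: h_def)
    also have "maximal_minor (\<lambda>r s. h s r) n n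
        = det (transpose_mat (mat n n (\<lambda>(r, s). f (if r < n then r else Suc r) s)))"
      unfolding maximal_minor_def h_def g_def by (intro arg_cong[where f = det] eq_matI) auto
    also have "\<dots> = maximal_minor f n n"
      unfolding maximal_minor_def by (rule det_transpose[where n = n]) auto
    finally show ?thesis
      by (simp flip: mult_2)
  qed
  have "?M t * ?M g = ?M h"
  proof (rule eq_matI)
    fix r s assume "r < dim_row (?M h)" "s < dim_col (?M h)"
    then have rs: "r \<le> n" "s \<le> n" by auto
    then have "(?M t * ?M g) $$ (r, s) = (\<Sum>k<Suc n. t r k * g k s)"
      by (auto simp: scalar_prod_def atLeast0LessThan intro!: sum.cong)
    also have "\<dots> = (\<Sum>k\<le>n. t r k * g k s)"
      by (simp add: lessThan_Suc_atMost)
    also have "\<dots> = h r s"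
    proof (cases "r = n")
      case True
      show ?thesis
      proof (cases "s = n")
        case s: True
        have "(\<Sum>k\<le>n. t r k * g k s) = (\<Sum>k\<le>n. if k = i then (-1) ^ k * w k else 0)"
          using True s by (intro sum.cong) (auto simp: t_def g_def)
        then show ?thesis
          using True s assms by (simp add: h_def)
      next
        case False
        then show ?thesis
          using True ker[of s] rs by (simp add: h_def t_def g_def)
      qed
    next
      case False
      have "(\<Sum>k\<le>n. t r k * g k s) = (\<Sum>k\<le>n. if k = r then g k s else 0)"
        using False by (intro sum.cong) (auto simp: t_def)
      then show ?thesis
        using False rs by (simp add: h_def)
    qed
    finally show "(?M t * ?M g) $$ (r, s) = ?M h $$ (r, s)"
      using rs by simp
  qed auto
  then have "det (?M t) * det (?M g) = det (?M h)"
    by (metis det_mult mat_carrier)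
  then have "(-1) ^ n * w n * ((-1) ^ (i + n) * maximal_minor f n i)
      = (-1) ^ i * (w i * maximal_minor f n n)"
    by (simp add: det_t det_g det_h mult.assoc)
  also have "(-1) ^ n * w n * ((-1) ^ (i + n) * maximal_minor f n i)
      = (-1) ^ i * (w n * maximal_minor f n i)"
    by (simp add: power_add algebra_simps flip: power_mult_distrib)
  \<comment> \<open>\<open>(-1) ^ i\<close> squares to 1, so one more factor cancels the
    sign.\<close>
  finally have "(-1) ^ i * ((-1) ^ i * (w n * maximal_minor f n i))
      = (-1) ^ i * ((-1) ^ i * (w i * maximal_minor f n n))"
    by simp
  then show ?thesis
    by (simp add: mult.assoc[symmetric] flip: power_mult_distrib)
qed

section \<open>The binomial identity behind the kernel vector\<close>

lemma coeff_one_plus_X_power: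
  "coeff ([:1, 1 :: 'a::comm_semiring_1:] ^ n) k = of_nat (n choose k)"
proof (cases "k \<le> n")
  case True
  then show ?thesis by (simp add: coeff_linear_poly_power)
next
  case False
  then have "degree ([:1, 1 :: 'a:] ^ n) < k"
    using degree_power_le[of "[:1, 1 :: 'a:]" n] by simp
  then show ?thesis
    using False by (simp add: coeff_eq_0 binomial_eq_0)
qed

text \<open>Multiplication by \<open>1 - x^2\<close> combines only the coefficients at
  \<open>k\<close> and \<open>k - 2\<close>, whose indices have the same parity.\<close>

lemma odd_coeff_one_minus_X_sq_power:
  assumes "odd k"
  shows "coeff ([:1, 0, -1 :: 'a::comm_ring_1:] ^ n) k = 0"
  using assms
proof (induction n arbitrary: k)
  case 0
  then show ?case by (cases k) auto
next
  case (Suc n)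
  show ?case
  proof (cases k)
    case 0
    then show ?thesis using Suc.prems by simp
  next
    case (Suc l)
    then show ?thesis
      using Suc.prems Suc.IH[of k] Suc.IH[of "k - 2"] by (cases l) auto
  qed
qed

lemma alternating_binomial_sum_odd:
  "(\<Sum>i\<le>d. (-1) ^ i * 2 ^ (d - i) * int (d choose i) * int ((d + i) choose (2 * s + 1))) = 0"
proof -
  \<comment> \<open>The factor \<open>1 - x\<close> is written as \<open>2 - (1 + x)\<close>, so
    that the binomial theorem produces powers of \<open>1 + x\<close> only.\<close>
  have "[:1, 0, -1 :: int:] ^ d = [:1, 1:] ^ d * (- [:1, 1:] + 2) ^ d"
    by (simp flip: power_mult_distrib add: numeral_poly)
  also have "\<dots> = (\<Sum>i\<le>d. [:(-1) ^ i * 2 ^ (d - i) * int (d choose i):] * [:1, 1:] ^ (d + i))"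
    unfolding binomial_ring sum_distrib_left
  proof (intro sum.cong refl)
    fix i
    have "(- [:1, 1 :: int:]) ^ i = [:(-1) ^ i:] * [:1, 1:] ^ i"
      by (subst power_minus) (simp add: minus_one_power_iff)
    moreover have "(2 :: int poly) ^ (d - i) = [:2 ^ (d - i):]"
      by (simp add: numeral_poly poly_const_pow)
    ultimately show "[:1, 1 :: int:] ^ d * (of_nat (d choose i) * (- [:1, 1:]) ^ i * 2 ^ (d - i))
        = [:(-1) ^ i * 2 ^ (d - i) * int (d choose i):] * [:1, 1:] ^ (d + i)"
      by (simp add: power_add of_nat_poly algebra_simps)
  qed
  finally have "coeff ([:1, 0, -1 :: int:] ^ d) (2 * s + 1) = coeff \<dots> (2 * s + 1)"
    by simp
  then show ?thesis
    by (simp add: odd_coeff_one_minus_X_sq_power coeff_sum coeff_one_plus_X_power mult.assoc)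
qed

text \<open>Absorption, the coefficient form of differentiating, turns
  \<open>(d + i) * ((d - 1 + i) choose (2 * s))\<close> into \<open>2 * s + 1\<close> times an
  odd-index binomial. The factor \<open>2 * s + 1\<close> does not depend on \<open>i\<close> and
  leaves the sum.\<close>

lemma binomial_left_kernel:
  assumes "d \<ge> 1"
  shows "(\<Sum>i\<le>d. (-1) ^ i * (2 ^ (d - i) * int (d choose i) * int (d + i))
           * int ((d - 1 + i) choose (2 * s))) = 0"
proof -
  have "int (d + i) * int ((d - 1 + i) choose (2 * s))
      = int (2 * s + 1) * int ((d + i) choose (2 * s + 1))" for i
    using Suc_times_binomial_eq[of "d - 1 + i" "2 * s"] assms
    by (simp flip: of_nat_mult add: algebra_simps)
  then have "(-1) ^ i * (2 ^ (d - i) * int (d choose i) * int (d + i))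
        * int ((d - 1 + i) choose (2 * s))
      = int (2 * s + 1) * ((-1) ^ i * 2 ^ (d - i) * int (d choose i)
          * int ((d + i) choose (2 * s + 1)))" for i
    by (simp only: mult.assoc mult.left_commute[of "int (2 * s + 1)"])
  then have "(\<Sum>i\<le>d. (-1) ^ i * (2 ^ (d - i) * int (d choose i) * int (d + i))
        * int ((d - 1 + i) choose (2 * s)))
      = int (2 * s + 1) * (\<Sum>i\<le>d. (-1) ^ i * 2 ^ (d - i) * int (d choose i)
          * int ((d + i) choose (2 * s + 1)))"
    unfolding sum_distrib_left by (intro sum.cong refl)
  then show ?thesis
    by (simp only: alternating_binomial_sum_odd mult_zero_right)
qed

section \<open>Evaluation of the binomial determinants\<close>

lemma D_eq_maximal_minor:
  assumes "d \<ge> 1" "i \<le> d"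
  shows "D d i = maximal_minor (\<lambda>r s. int ((d - 1 + r) choose (2 * s))) d i"
proof -
  have "[d - 1..<2 * d] = [d - 1..<d - 1 + i] @ (d - 1 + i) # [d + i..<2 * d]"
    using assms upt_add_eq_append[of "d - 1" "d - 1 + i" "d + 1 - i"]
      upt_conv_Cons[of "d - 1 + i" "2 * d"] by (simp add: mult_2)
  then have "filter (\<lambda>k. k \<noteq> d - 1 + i) [d - 1..<2 * d]
      = [d - 1..<d - 1 + i] @ [d + i..<2 * d]"
    using assms by (auto simp: filter_id_conv)
  then show ?thesis
    using assms unfolding D_def binomial_det_def maximal_minor_def
    by (intro arg_cong[where f = det] eq_matI) (auto simp: nth_append)
qed

text \<open>Vandermonde's convolution factors the left matrix through the unitriangular Pascal
  matrix \<open>r choose j\<close>. The guard \<open>j \<le> b s\<close> is essential: truncated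
  subtraction would otherwise give the entry 1.\<close>

lemma det_consecutive_binomials:
  "det (mat m m (\<lambda>(r, s). int ((n + r) choose b s)))
    = det (mat m m (\<lambda>(j, s). if j \<le> b s then int (n choose (b s - j)) else 0))"
  (is "det ?A = det ?N")
proof -
  let ?L = "mat m m (\<lambda>(r, j). int (r choose j))"
  have "det ?L = prod_list (diag_mat ?L)"
    by (rule det_lower_triangular[where n = m]) auto
  also have "\<dots> = 1"
    unfolding prod_list_diag_prod by (intro prod.neutral) auto
  finally have "det ?L = 1" .
  moreover have "?A = ?L * ?N"
  proof (rule eq_matI)
    fix r s assume "r < dim_row (?L * ?N)" "s < dim_col (?L * ?N)"
    then have rs: "r < m" "s < m" by auto
    let ?g = "\<lambda>j. int (r choose j) * (if j \<le> b s then int (n choose (b s - j)) else 0)"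
    have "(?L * ?N) $$ (r, s) = (\<Sum>j<m. ?g j)"
      using rs by (auto simp: scalar_prod_def atLeast0LessThan intro!: sum.cong)
    \<comment> \<open>A range containing both index sets: terms with \<open>j \<ge> m\<close> vanish
      because \<open>r < m\<close>, those with \<open>j > b s\<close> by the guard.\<close>
    also have "\<dots> = (\<Sum>j<m + Suc (b s). ?g j)"
      using rs by (intro sum.mono_neutral_left) auto
    also have "\<dots> = (\<Sum>j\<le>b s. ?g j)"
      by (intro sum.mono_neutral_right) auto
    also have "\<dots> = int (\<Sum>j\<le>b s. (r choose j) * (n choose (b s - j)))"
      by simp
    also have "\<dots> = int ((n + r) choose b s)"
      by (simp only: vandermonde add.commute)
    finally show "?A $$ (r, s) = (?L * ?N) $$ (r, s)"
      using rs by simp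
  qed auto
  moreover have "det (?L * ?N) = det ?L * det ?N"
    by (rule det_mult) auto
  ultimately show ?thesis
    by simp
qed

lemma D_Suc_Suc:
  assumes "d \<ge> 1"
  shows "D (Suc d) (Suc d) = D d 0"
proof -
  define f where "f j s = (if j \<le> 2 * s then int (d choose (2 * s - j)) else 0)" for j s
  have "D (Suc d) (Suc d) = det (mat (Suc d) (Suc d) (\<lambda>(r, s). int ((d + r) choose (2 * s))))"
    by (subst D_eq_maximal_minor)
      (auto simp: maximal_minor_def intro!: arg_cong[where f = det] eq_matI)
  also have "\<dots> = det (mat (Suc d) (Suc d) (\<lambda>(j, s). f j s))"
    unfolding f_def by (rule det_consecutive_binomials)
  \<comment> \<open>In column \<open>d\<close> the entry is \<open>d choose (2 * d - j)\<close> with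
    \<open>j \<le> d\<close>, which is nonzero only for \<open>j = d\<close>.\<close>
  also have "\<dots> = (-1) ^ (d + d) * 1 * maximal_minor f d d"
    by (rule det_last_column_unit) (auto simp: f_def)
  also have "\<dots> = det (mat d d (\<lambda>(j, s). f j s))"
    by (auto simp: maximal_minor_def simp flip: mult_2 intro!: arg_cong[where f = det] eq_matI)
  also have "\<dots> = det (mat d d (\<lambda>(r, s). int ((d + r) choose (2 * s))))"
    unfolding f_def by (rule det_consecutive_binomials[symmetric])
  also have "\<dots> = D d 0"
    using assms by (subst D_eq_maximal_minor)
      (auto simp: maximal_minor_def intro!: arg_cong[where f = det] eq_matI)
  finally show ?thesis .
qed

text \<open>The kernel vector is compared at positions \<open>i\<close> and \<open>d\<close>; its
  entry at \<open>d\<close> is \<open>2 * d\<close>.\<close>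

lemma D_proportional:
  assumes "d \<ge> 1" "i \<le> d"
  shows "2 * int d * D d i = 2 ^ (d - i) * int (d choose i) * int (d + i) * D d d"
proof -
  have "2 ^ (d - d) * int (d choose d) * int (d + d) * D d i
      = 2 ^ (d - i) * int (d choose i) * int (d + i) * D d d"
    unfolding D_eq_maximal_minor[OF assms] D_eq_maximal_minor[OF assms(1) order_refl]
    by (rule maximal_minors_proportional_to_left_kernel
        [OF binomial_left_kernel[OF assms(1)] assms(2)])
  then show ?thesis
    by simp
qed

text \<open>Proportionality at \<open>i = 0\<close> gives
  \<open>D d 0 = 2 ^ (d - 1) * D d d\<close>, and \<open>D d 0\<close> is the next diagonal value,
  so the exponents add up to a triangular number.\<close>

lemma D_diagonal: "D (Suc n) (Suc n) = 2 ^ (n * (n - 1) div 2)"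
proof (induction n)
  case 0
  show ?case
    by (simp add: D_eq_maximal_minor maximal_minor_def det_single)
next
  case (Suc n)
  have "2 * int (Suc n) * D (Suc n) 0 = 2 * int (Suc n) * (2 ^ n * D (Suc n) (Suc n))"
    using D_proportional[of "Suc n" 0] by simp
  then have "D (Suc n) 0 = 2 ^ n * D (Suc n) (Suc n)"
    by (simp only: mult_cancel_left) simp
  moreover have "n + n * (n - 1) div 2 = Suc n * n div 2"
    by (cases n) (auto simp: algebra_simps)
  ultimately show ?case
    by (simp add: D_Suc_Suc Suc.IH flip: power_add)
qed

theorem theorem2:
  fixes d i :: nat
  assumes "d \<ge> 1" and "i \<le> d"
  shows "(of_int (D d i) :: rat) =
    2 powi (int (d * (d - 1) div 2) - int i) * of_nat (d choose i) * (of_nat (d + i) / of_nat d)"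
proof -
  obtain n where n: "d = Suc n"
    using assms(1) by (cases d) auto
  define e where "e = n * (n - 1) div 2"
  have e: "d * (d - 1) div 2 = n + e"
    unfolding n e_def by (cases n) (auto simp: algebra_simps)
  have "2 * int d * D d i = 2 ^ (d - i) * int (d choose i) * int (d + i) * 2 ^ e"
    using D_proportional[OF assms] D_diagonal[of n] by (simp add: n e_def)
  then have "(of_int (2 * int d * D d i) :: rat)
      = of_int (2 ^ (d - i) * int (d choose i) * int (d + i) * 2 ^ e)"
    by (rule arg_cong)
  then have "2 * of_nat d * (of_int (D d i) :: rat)
      = 2 ^ (d - i + e) * of_nat (d choose i) * of_nat (d + i)"
    by (simp add: power_add mult_ac)
  moreover have "(2 :: rat) ^ (d - i + e) = 2 * 2 powi (int (d * (d - 1) div 2) - int i)"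
  proof -
    \<comment> \<open>The exponent on the right-hand side of the theorem can be -1, as for
      \<open>d = i = 1\<close>. The extra factor 2 makes it a natural number, and
      \<open>i \<le> d\<close> keeps \<open>d - i\<close> exact.\<close>
    have "int (d - i + e) = 1 + (int (d * (d - 1) div 2) - int i)"
      using assms unfolding e by (simp add: n)
    then show ?thesis
      by (metis power_int_add power_int_1_right power_int_of_nat zero_neq_numeral)
  qed
  ultimately show ?thesis
    using assms(1) by (simp add: field_simps)
qed

end
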